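(* Let $\mathfrak C$ be a permutational category with parent group $\Gamma$, and let $\mathcal O$ be an object of $\mathfrak C$, identified with a permutation representation $\theta:\Gamma\to S={\rm Sym}(\Omega)$, with monodromy group $G=\theta(\Gamma)$. If $G$ is a primitive permutation group on $\Omega$, then either $\mathcal O$ is regular, with ${\rm Aut}_{\mathfrak C}(\mathcal O)=G\cong C_p$ for some prime $p$, or ${\rm Aut}_{\mathfrak C}(\mathcal O)$ is the trivial group.
   Context: A permutational category $\mathfrak C$ with parent group $\Gamma$ is a category whose objects $\mathcal O$ are identified with the permutation representations $\theta:\Gamma\to S={\rm Sym}(\Omega)$ of the group $\Gamma$ on sets $\Omega$, and whose morphisms $\mathcal O_1\to\mathcal O_2$ are identified with the functions $\Omega_1\to\Omega_2$ commuting with the actions of $\Gamma$. The group $\Gamma$ and the set $\Omega$ may be infinite. The monodromy group of $\mathcal O$ is $G=\theta(\Gamma)\le S$. The automorphism group ${\rm Aut}_{\mathfrak C}(\mathcal O)$ is the group of all permutations of $\Omega$ commuting with the action of $\Gamma$, that is, the centraliser $C_S(G)$ of $G$ in $S$ (so the equality ${\rm Aut}_{\mathfrak C}(\mathcal O)=G$ is an equality of subgroups of $S$). An object $\mathcal O$ is regular if ${\rm Aut}_{\mathfrak C}(\mathcal O)$ acts transitively on $\Omega$; for $G$ transitive this is equivalent to $G$ acting regularly on $\Omega$ (transitively with trivial point stabilisers). A permutation group $G\le{\rm Sym}(\Omega)$, with $\Omega$ non-empty, is primitive if it is transitive on $\Omega$ and the only $G$-invariant equivalence relations on $\Omega$ are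 the identity relation and the universal relation. $C_p$ denotes a cyclic group of order $p$. *)

theory Defs
  imports "HOL-Algebra.Algebra"
begin

section \<open>Permutation groups\<close>

text \<open>
  \<^term>\<open>BijGroup \<Omega>\<close> is the symmetric group of \<open>\<Omega>\<close>; its elements are the permutations of \<open>\<Omega>\<close>,
  represented as functions that are \<^term>\<open>undefined\<close> outside \<open>\<Omega>\<close>. Hence equality of sets of
  permutations is equality of subgroups of the symmetric group.
\<close>

definition perm_group :: "'x set \<Rightarrow> ('x \<Rightarrow> 'x) set \<Rightarrow> ('x \<Rightarrow> 'x) monoid"
  where "perm_group \<Omega> H = BijGroup \<Omega> \<lparr>carrier := H\<rparr>"

definition transitive_perm_group :: "'x set \<Rightarrow> ('x \<Rightarrow> 'x) set \<Rightarrow> bool"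
  where "transitive_perm_group \<Omega> H \<longleftrightarrow> transitive_action (perm_group \<Omega> H) \<Omega> (\<lambda>h. h)"

definition invariant_equiv :: "'x set \<Rightarrow> ('x \<Rightarrow> 'x) set \<Rightarrow> ('x \<times> 'x) set \<Rightarrow> bool"
  where "invariant_equiv \<Omega> H R \<longleftrightarrow>
    equiv \<Omega> R \<and> (\<forall>h\<in>H. \<forall>x y. (x, y) \<in> R \<longrightarrow> (h x, h y) \<in> R)"

definition primitive_perm_group :: "'x set \<Rightarrow> ('x \<Rightarrow> 'x) set \<Rightarrow> bool"
  where "primitive_perm_group \<Omega> H \<longleftrightarrow>
    \<Omega> \<noteq> {} \<and> subgroup H (BijGroup \<Omega>) \<and> transitive_perm_group \<Omega> H \<and>
    (\<forall>R. invariant_equiv \<Omega> H R \<longrightarrow> R = Id_on \<Omega> \<or> R = \<Omega> \<times> \<Omega>)"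


section \<open>The permutational category with parent group \<open>\<Gamma>\<close>\<close>

record ('g, 'x) perm_rep =
  points :: "'x set"
  action :: "'g \<Rightarrow> 'x \<Rightarrow> 'x"

definition perm_cat_objects :: "('g, 'm) monoid_scheme \<Rightarrow> ('g, 'x) perm_rep set"
  where "perm_cat_objects \<Gamma> = {A. group_action \<Gamma> (points A) (action A)}"

definition perm_cat_hom ::
    "('g, 'm) monoid_scheme \<Rightarrow> ('g, 'x) perm_rep \<Rightarrow> ('g, 'y) perm_rep \<Rightarrow> ('x \<Rightarrow> 'y) set"
  where "perm_cat_hom \<Gamma> A B =
    {f \<in> points A \<rightarrow>\<^sub>E points B.
      \<forall>g\<in>carrier \<Gamma>. \<forall>x\<in>points A. f (action A g x) = action B g (f x)}"

definition monodromy_group ::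
    "('g, 'm) monoid_scheme \<Rightarrow> ('g, 'x) perm_rep \<Rightarrow> ('x \<Rightarrow> 'x) set"
  where "monodromy_group \<Gamma> A = action A ` carrier \<Gamma>"

definition perm_cat_aut ::
    "('g, 'm) monoid_scheme \<Rightarrow> ('g, 'x) perm_rep \<Rightarrow> ('x \<Rightarrow> 'x) set"
  where "perm_cat_aut \<Gamma> A = perm_cat_hom \<Gamma> A A \<inter> Bij (points A)"

definition regular_object :: "('g, 'm) monoid_scheme \<Rightarrow> ('g, 'x) perm_rep \<Rightarrow> bool"
  where "regular_object \<Gamma> A \<longleftrightarrow> transitive_perm_group (points A) (perm_cat_aut \<Gamma> A)"


section \<open>Consistency of the definitions\<close>

lemma transitive_perm_group_iff:
  assumes "subgroup H (BijGroup \<Omega>)"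
  shows "transitive_perm_group \<Omega> H \<longleftrightarrow> (\<forall>x\<in>\<Omega>. \<forall>y\<in>\<Omega>. \<exists>h\<in>H. h x = y)"
proof -
  have "group (perm_group \<Omega> H)"
    unfolding perm_group_def
    by (rule subgroup.subgroup_is_group[OF assms group_BijGroup])
  moreover have "(\<lambda>h. h) \<in> hom (perm_group \<Omega> H) (BijGroup \<Omega>)"
    using subgroup.subset[OF assms] by (auto simp: hom_def perm_group_def)
  ultimately have "group_action (perm_group \<Omega> H) \<Omega> (\<lambda>h. h)"
    by (simp add: group_action_def group_hom_def group_hom_axioms_def group_BijGroup)
  then show ?thesis
    by (auto simp: transitive_perm_group_def transitive_action_def transitive_action_axioms_def
        perm_group_def)
qed

lemma perm_cat_hom_id: "A \<in> perm_cat_objects \<Gamma> \<Longrightarrow> (\<lambda>x\<in>points A. x) \<in> perm_cat_hom \<Gamma> A A"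
  by (auto simp: perm_cat_hom_def perm_cat_objects_def group_action.element_image)

lemma perm_cat_hom_compose:
  assumes "A \<in> perm_cat_objects \<Gamma>"
    and "f \<in> perm_cat_hom \<Gamma> A B" and "h \<in> perm_cat_hom \<Gamma> B C"
  shows "compose (points A) h f \<in> perm_cat_hom \<Gamma> A C"
  using assms
  by (auto simp: perm_cat_hom_def perm_cat_objects_def compose_def PiE_iff
      group_action.element_image)

lemma monodromy_group_subgroup:
  assumes "A \<in> perm_cat_objects \<Gamma>"
  shows "subgroup (monodromy_group \<Gamma> A) (BijGroup (points A))"
  using assms group_action.group_hom[of \<Gamma> "points A" "action A"]
  by (auto simp: perm_cat_objects_def monodromy_group_def intro: group_hom.img_is_subgroup)

lemma perm_cat_aut_eq_centraliser:
  assumes "A \<in> perm_cat_objects \<Gamma>"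
  shows "perm_cat_aut \<Gamma> A =
    {f \<in> carrier (BijGroup (points A)). \<forall>h\<in>monodromy_group \<Gamma> A.
      f \<otimes>\<^bsub>BijGroup (points A)\<^esub> h = h \<otimes>\<^bsub>BijGroup (points A)\<^esub> f}" (is "?L = ?R")
proof -
  have bij: "action A g \<in> Bij (points A)" if "g \<in> carrier \<Gamma>" for g
    using assms that by (simp add: perm_cat_objects_def group_action.bij_prop0)
  have eq: "compose (points A) f (action A g) = compose (points A) (action A g) f \<longleftrightarrow>
      (\<forall>x\<in>points A. f (action A g x) = action A g (f x))" for f g
    by (auto simp: compose_def fun_eq_iff restrict_def)
  have "f \<in> ?L \<longleftrightarrow> f \<in> ?R" for f
    using bij by (auto simp: perm_cat_aut_def perm_cat_hom_def monodromy_group_def BijGroup_def eq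
        PiE_iff Bij_imp_extensional dest: Bij_imp_funcset)
  then show ?thesis by blast
qed

lemma perm_cat_aut_eq_invertible:
  assumes "A \<in> perm_cat_objects \<Gamma>"
  shows "perm_cat_aut \<Gamma> A =
    {f \<in> perm_cat_hom \<Gamma> A A. \<exists>h\<in>perm_cat_hom \<Gamma> A A.
      compose (points A) h f = (\<lambda>x\<in>points A. x) \<and> compose (points A) f h = (\<lambda>x\<in>points A. x)}"
    (is "?A = ?I")
proof (intro equalityI subsetI)
  fix f assume f: "f \<in> ?A"
  let ?h = "\<lambda>x\<in>points A. inv_into (points A) f x"
  have bij: "bij_betw f (points A) (points A)" and hom: "f \<in> perm_cat_hom \<Gamma> A A"
    using f by (auto simp: perm_cat_aut_def Bij_def)
  have act: "action A g x \<in> points A" if "g \<in> carrier \<Gamma>" "x \<in> points A" for g x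
    using assms that by (auto simp: perm_cat_objects_def group_action.element_image)
  have inv: "inv_into (points A) f x \<in> points A" "f (inv_into (points A) f x) = x"
    if "x \<in> points A" for x
    using bij that by (auto simp: bij_betw_def inv_into_into f_inv_into_f)
  have "inv_into (points A) f (action A g x) = action A g (inv_into (points A) f x)"
    if "g \<in> carrier \<Gamma>" "x \<in> points A" for g x
  proof (rule inv_into_f_eq)
    show "inj_on f (points A)" using bij by (simp add: bij_betw_def)
    show "action A g (inv_into (points A) f x) \<in> points A" using act inv that by blast
    show "f (action A g (inv_into (points A) f x)) = action A g x"
      using hom inv that by (simp add: perm_cat_hom_def)
  qed
  then have "?h \<in> perm_cat_hom \<Gamma> A A"
    using act inv by (auto simp: perm_cat_hom_def)
  moreover have "compose (points A) ?h f = (\<lambda>x\<in>points A. x)"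
    using f by (auto simp: perm_cat_aut_def Bij_compose_restrict_eq)
  moreover have "compose (points A) f ?h = (\<lambda>x\<in>points A. x)"
    using inv by (auto simp: compose_def fun_eq_iff)
  ultimately show "f \<in> ?I" using hom by blast
next
  fix f assume "f \<in> ?I"
  then obtain h where f: "f \<in> perm_cat_hom \<Gamma> A A" and h: "h \<in> perm_cat_hom \<Gamma> A A"
    and l: "compose (points A) h f = (\<lambda>x\<in>points A. x)"
    and r: "compose (points A) f h = (\<lambda>x\<in>points A. x)" by blast
  have "bij_betw f (points A) (points A)"
  proof (rule bij_betw_byWitness[where f' = h])
    show "\<forall>x\<in>points A. h (f x) = x" using l by (metis compose_eq restrict_apply')
    show "\<forall>x\<in>points A. f (h x) = x" using r by (metis compose_eq restrict_apply')
  qed (use f h in \<open>auto simp: perm_cat_hom_def\<close>)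
  then show "f \<in> ?A" using f by (auto simp: perm_cat_aut_def perm_cat_hom_def Bij_def PiE_iff)
qed

lemma perm_cat_aut_subgroup:
  assumes "A \<in> perm_cat_objects \<Gamma>"
  shows "subgroup (perm_cat_aut \<Gamma> A) (BijGroup (points A))"
proof -
  interpret S: group "BijGroup (points A)" by (rule group_BijGroup)
  have M: "monodromy_group \<Gamma> A \<subseteq> carrier (BijGroup (points A))"
    by (rule subgroup.subset[OF monodromy_group_subgroup[OF assms]])
  show ?thesis
    unfolding perm_cat_aut_eq_centraliser[OF assms]
  proof (rule S.subgroupI, goal_cases)
    case 2
    have "\<one>\<^bsub>BijGroup (points A)\<^esub> \<otimes>\<^bsub>BijGroup (points A)\<^esub> h =
        h \<otimes>\<^bsub>BijGroup (points A)\<^esub> \<one>\<^bsub>BijGroup (points A)\<^esub>" if "h \<in> monodromy_group \<Gamma> A" for h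
      using M that by auto
    then show ?case using S.one_closed by blast
  next
    case (3 f)
    then show ?case using M S.inv_comm
      by (smt (verit, best) S.inv_closed S.inv_solve_left' S.m_assoc S.m_closed S.inv_solve_right
          mem_Collect_eq subsetD)
  next
    case (4 f k)
    then show ?case using M by (smt (verit) S.m_assoc S.m_closed mem_Collect_eq subsetD)
  qed auto
qed

end

theory Submission
  imports Defs
begin

text \<open>
  Beyond transitivity of \<open>G\<close>, primitivity enters through one observation: if a group \<open>K\<close> of permutations
  commutes with \<open>G\<close>, then \<open>G\<close> permutes the orbits of \<open>K\<close>, so that lying in a common orbit is an
  equivalence relation invariant under \<open>G\<close>. Primitivity forces every such \<open>K\<close> to be trivial or
  transitive (\<open>primitive_centralising_subgroup\<close>).

  Two permutations that commute with a transitive set of permutations and agree at one point are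
  equal (\<open>commuting_with_transitive_eqI\<close>). As \<open>G\<close> is transitive, an automorphism is therefore
  determined by its value at one point. Hence a transitive subgroup \<open>K\<close> of the automorphism group
  \<open>C\<close> is all of \<open>C\<close>, and by the observation above \<open>C\<close> has no subgroups besides \<open>1\<close> and itself.
  If \<open>C \<noteq> 1\<close>, then \<open>C\<close> is cyclic of prime order (\<open>only_trivial_subgroups_imp_prime_cyclic\<close>), and
  it is transitive, which is regularity of the object.

  It remains to compare \<open>C\<close> with \<open>G\<close>. Now \<open>C\<close> is transitive and abelian, so both the elements of
  \<open>G\<close> and those of \<open>C\<close> commute with \<open>C\<close>. Given \<open>g \<in> G\<close> and a point \<open>x\<close>, some \<open>c \<in> C\<close> has
  \<open>c x = g x\<close>, whence \<open>c = g\<close>. So \<open>G \<subseteq> C\<close>; and then \<open>G\<close>, being a transitive subgroup of \<open>C\<close>,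
  equals \<open>C\<close>.
\<close>

section \<open>Groups without proper non-trivial subgroups\<close>

text \<open>
  The order \<open>ord a\<close> is \<open>0\<close> when \<open>a\<close> has infinite order, and \<open>integer_mod_group 0\<close> is the group of
  integers, so finite and infinite cyclic groups need no separate treatment.
\<close>

lemma (in group) cyclic_iso_integer_mod_group:
  assumes a: "a \<in> carrier G" and gen: "carrier G = range (\<lambda>n::int. a [^] n)"
  shows "G \<cong> integer_mod_group (ord a)"
proof -
  let ?Z = "integer_mod_group (ord a)" and ?h = "\<lambda>n::int. a [^] n"
  have eq_iff: "a [^] m = a [^] n \<longleftrightarrow> int (ord a) dvd m - n" for m n :: int
  proof -
    have "a [^] m = a [^] (m - n) \<otimes> a [^] n"
      using a int_pow_mult[of a "m - n" n] by simp
    then show ?thesis using a by (simp flip: int_pow_eq_id)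
  qed
  have pow_mod: "a [^] (n mod int (ord a)) = a [^] n" for n :: int
    by (simp add: eq_iff mod_eq_dvd_iff [symmetric])
  have "?h \<in> hom ?Z G"
    using a by (auto simp: hom_def pow_mod int_pow_mult)
  moreover have "inj_on ?h (carrier ?Z)"
    by (auto simp: inj_on_def eq_iff carrier_integer_mod_group mod_eq_dvd_iff [symmetric]
        split: if_splits)
  moreover have "?h ` carrier ?Z = carrier G"
  proof
    show "?h ` carrier ?Z \<subseteq> carrier G" using a by auto
    have "n mod int (ord a) \<in> carrier ?Z" for n
      by (simp add: carrier_integer_mod_group)
    then show "carrier G \<subseteq> ?h ` carrier ?Z"
      unfolding gen using pow_mod by (metis image_iff image_subsetI)
  qed
  ultimately have "?h \<in> iso ?Z G" by (simp add: iso_def bij_betw_def)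
  then show ?thesis
    by (meson is_isoI group.iso_sym group_integer_mod_group)
qed

text \<open>
  Any \<open>a \<noteq> 1\<close> generates the group, and for every \<open>k\<close> the power \<open>a\<^sup>k\<close> is either trivial or again
  a generator: either \<open>ord a\<close> divides \<open>k\<close> or it is coprime to \<open>k\<close>. Among the natural numbers other
  than \<open>1\<close> only primes have this property, and \<open>0\<close> (infinite order) is excluded by \<open>k = 2\<close>.
\<close>

lemma (in group) only_trivial_subgroups_imp_prime_cyclic:
  assumes nontriv: "carrier G \<noteq> {\<one>}"
    and sub: "\<And>H. subgroup H G \<Longrightarrow> H = {\<one>} \<or> H = carrier G"
  obtains p :: nat where "Factorial_Ring.prime p" and "G \<cong> integer_mod_group p"
proof -
  obtain a where a: "a \<in> carrier G" "a \<noteq> \<one>"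
    using nontriv one_closed by blast
  have gen: "carrier G = range (\<lambda>n::int. x [^] n)" if "x \<in> carrier G" "x \<noteq> \<one>" for x
    using sub[OF subgroup_of_powers[OF that(1)]] that by (metis int_pow_1 rangeI singletonD)
  define p where "p = ord a"
  have dich: "int p dvd k \<or> coprime (int p) k" for k
  proof (cases "a [^] k = \<one>")
    case True
    then show ?thesis using a by (simp add: p_def int_pow_eq_id)
  next
    case False
    then obtain m :: int where "a = (a [^] k) [^] m"
      using gen[of "a [^] k"] a by auto
    then have "a [^] (k * m - 1) = \<one>"
      using a by (metis int_pow_1 int_pow_diff int_pow_pow r_inv)
    then have dvd: "int p dvd k * m - 1" using a by (simp add: p_def int_pow_eq_id)
    have "coprime (int p) k"
    proof (rule coprimeI)
      fix d assume "d dvd int p" "d dvd k"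
      then have "d dvd k * m - (k * m - 1)"
        by (meson dvd dvd_diff dvd_mult2 dvd_trans)
      then show "is_unit d" by simp
    qed
    then show ?thesis ..
  qed
  have "p \<noteq> 1" using a ord_eq_1[of a] by (simp add: p_def)
  moreover have "p \<noteq> 0" using dich[of 2] by (intro notI) simp
  moreover have "k = 1 \<or> k = p" if "k dvd p" for k
  proof -
    have "p dvd k \<or> coprime p k" using dich[of "int k"] by simp
    then show ?thesis
      using that by (metis coprime_absorb_right dvd_antisym nat_dvd_1_iff_1)
  qed
  ultimately have "Factorial_Ring.prime p" by (auto simp: prime_nat_iff)
  moreover have "G \<cong> integer_mod_group p"
    unfolding p_def using a gen by (intro cyclic_iso_integer_mod_group)
  ultimately show thesis by (rule that)
qed

section \<open>Permutations commuting with a transitive or primitive group\<close>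

lemma commuting_with_transitive_eqI:
  assumes trans: "\<And>y. y \<in> \<Omega> \<Longrightarrow> \<exists>t\<in>T. t x = y"
    and f: "f \<in> extensional \<Omega>" "\<And>t. t \<in> T \<Longrightarrow> f (t x) = t (f x)"
    and g: "g \<in> extensional \<Omega>" "\<And>t. t \<in> T \<Longrightarrow> g (t x) = t (g x)"
    and agree: "f x = g x"
  shows "f = g"
proof (rule extensionalityI[OF f(1) g(1)])
  fix y assume "y \<in> \<Omega>"
  then obtain t where "t \<in> T" "t x = y" using trans by blast
  then show "f y = g y" using f(2) g(2) agree by metis
qed

lemma group_action_perm_group:
  assumes "subgroup K (BijGroup \<Omega>)"
  shows "group_action (perm_group \<Omega> K) \<Omega> (\<lambda>k. k)"
proof -
  have "group (perm_group \<Omega> K)"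
    unfolding perm_group_def by (rule subgroup.subgroup_is_group[OF assms group_BijGroup])
  moreover have "(\<lambda>k. k) \<in> hom (perm_group \<Omega> K) (BijGroup \<Omega>)"
    using subgroup.subset[OF assms] by (auto simp: hom_def perm_group_def)
  ultimately show ?thesis
    by (simp add: group_action_def group_hom_def group_hom_axioms_def group_BijGroup)
qed

text \<open>
  A permutation that commutes with \<open>K\<close> maps each \<open>K\<close>-orbit onto a \<open>K\<close>-orbit, so the orbit
  relation of \<open>K\<close> is \<open>H\<close>-invariant. If it is the identity relation, \<open>K\<close> fixes every point; if it
  is the universal relation, \<open>K\<close> is transitive.
\<close>

lemma primitive_centralising_subgroup:
  assumes prim: "primitive_perm_group \<Omega> H"
    and K: "subgroup K (BijGroup \<Omega>)"
    and comm: "\<And>k h x. k \<in> K \<Longrightarrow> h \<in> H \<Longrightarrow> x \<in> \<Omega> \<Longrightarrow> k (h x) = h (k x)"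
  shows "K = {\<one>\<^bsub>BijGroup \<Omega>\<^esub>} \<or> transitive_perm_group \<Omega> K"
proof -
  interpret act: group_action "perm_group \<Omega> K" \<Omega> "\<lambda>k. k"
    by (rule group_action_perm_group[OF K])
  define R where "R = {(x, y). x \<in> \<Omega> \<and> y \<in> \<Omega> \<and> y \<in> orbit (perm_group \<Omega> K) (\<lambda>k. k) x}"
  have orbit_iff: "y \<in> orbit (perm_group \<Omega> K) (\<lambda>k. k) x \<longleftrightarrow> (\<exists>k\<in>K. k x = y)" for x y
    by (auto simp: orbit_def perm_group_def)
  have K_Bij: "k \<in> Bij \<Omega>" if "k \<in> K" for k
    using subgroup.subset[OF K] that by (auto simp: BijGroup_def)
  have H_Bij: "h \<in> Bij \<Omega>" if "h \<in> H" for h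
    using prim subgroup.subset[of H "BijGroup \<Omega>"] that
    by (auto simp: primitive_perm_group_def BijGroup_def)
  have "equiv \<Omega> R"
  proof (rule equivI)
    show "R \<subseteq> \<Omega> \<times> \<Omega>" by (auto simp: R_def)
    show "refl_on \<Omega> R" by (auto simp: refl_on_def R_def act.orbit_refl)
    show "sym R" using act.orbit_sym by (auto simp: sym_def R_def)
    show "trans R" unfolding trans_def R_def using act.orbit_trans by blast
  qed
  moreover have "(h x, h y) \<in> R" if "h \<in> H" "(x, y) \<in> R" for h x y
    using that comm[OF _ that(1)] Bij_imp_funcset[OF H_Bij[OF that(1)]]
    unfolding R_def orbit_iff by auto
  ultimately have "invariant_equiv \<Omega> H R" by (simp add: invariant_equiv_def)
  then consider "R = Id_on \<Omega>" | "R = \<Omega> \<times> \<Omega>"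
    using prim by (auto simp: primitive_perm_group_def)
  then show ?thesis
  proof cases
    case 1
    have "k = \<one>\<^bsub>BijGroup \<Omega>\<^esub>" if k: "k \<in> K" for k
    proof (rule extensionalityI[of _ \<Omega>])
      show "k \<in> extensional \<Omega>" by (rule Bij_imp_extensional[OF K_Bij[OF k]])
      show "\<one>\<^bsub>BijGroup \<Omega>\<^esub> \<in> extensional \<Omega>" by (simp add: BijGroup_def)
      fix x assume x: "x \<in> \<Omega>"
      have "k x \<in> \<Omega>" using Bij_imp_funcset[OF K_Bij[OF k]] x by blast
      then have "(x, k x) \<in> R" using k x by (auto simp: R_def orbit_iff)
      then show "k x = \<one>\<^bsub>BijGroup \<Omega>\<^esub> x" using 1 x by (auto simp: BijGroup_def)
    qed
    then show ?thesis using subgroup.one_closed[OF K] by blast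
  next
    case 2
    have "\<exists>k\<in>K. k x = y" if "x \<in> \<Omega>" "y \<in> \<Omega>" for x y
    proof -
      have "(x, y) \<in> R" using 2 that by simp
      then show ?thesis by (simp add: R_def orbit_iff)
    qed
    then show ?thesis by (simp add: transitive_perm_group_iff[OF K])
  qed
qed

section \<open>Automorphisms of objects with primitive monodromy group\<close>

theorem corollary9:
  fixes \<Gamma> :: "('g, 'm) monoid_scheme" and A :: "('g, 'x) perm_rep"
  assumes "group \<Gamma>"
    and "A \<in> perm_cat_objects \<Gamma>"
    and "primitive_perm_group (points A) (monodromy_group \<Gamma> A)"
  shows "(regular_object \<Gamma> A \<and>
          perm_cat_aut \<Gamma> A = monodromy_group \<Gamma> A \<and>
          (\<exists>p::nat. Factorial_Ring.prime p \<and>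
            perm_group (points A) (monodromy_group \<Gamma> A) \<cong> integer_mod_group p)) \<or>
         trivial_group (perm_group (points A) (perm_cat_aut \<Gamma> A))"
proof -
  let ?\<Omega> = "points A" and ?G = "monodromy_group \<Gamma> A" and ?C = "perm_cat_aut \<Gamma> A"
  let ?B = "BijGroup ?\<Omega>" and ?P = "perm_group ?\<Omega> ?C"
  interpret B: group ?B by (rule group_BijGroup)
  have C: "subgroup ?C ?B" by (rule perm_cat_aut_subgroup[OF assms(2)])
  have G: "subgroup ?G ?B" by (rule monodromy_group_subgroup[OF assms(2)])
  interpret P: group ?P
    unfolding perm_group_def by (rule subgroup.subgroup_is_group[OF C group_BijGroup])
  have carrier_P: "carrier ?P = ?C" and one_P: "\<one>\<^bsub>?P\<^esub> = \<one>\<^bsub>?B\<^esub>"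
    by (simp_all add: perm_group_def)
  have Bij: "f \<in> Bij ?\<Omega>" if "f \<in> ?C \<or> f \<in> ?G" for f
    using that subgroup.subset[OF C] subgroup.subset[OF G] by (auto simp: BijGroup_def)
  have ext: "f \<in> extensional ?\<Omega>" if "f \<in> ?C \<or> f \<in> ?G" for f
    by (rule Bij_imp_extensional[OF Bij[OF that]])
  have closed: "f x \<in> ?\<Omega>" if "f \<in> ?C \<or> f \<in> ?G" "x \<in> ?\<Omega>" for f x
    using Bij_imp_funcset[OF Bij[OF that(1)]] that(2) by blast
  have CG: "c (g x) = g (c x)" if "c \<in> ?C" "g \<in> ?G" "x \<in> ?\<Omega>" for c g x
    using that by (auto simp: perm_cat_aut_def perm_cat_hom_def monodromy_group_def)
  have G_trans: "\<exists>g\<in>?G. g x = y" if "x \<in> ?\<Omega>" "y \<in> ?\<Omega>" for x y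
    using assms(3) that by (simp add: primitive_perm_group_def transitive_perm_group_iff[OF G])
  obtain x where x: "x \<in> ?\<Omega>" using assms(3) by (auto simp: primitive_perm_group_def)
  have C_eqI: "c = d" if "c \<in> ?C" "d \<in> ?C" "c x = d x" for c d
    by (rule commuting_with_transitive_eqI[where \<Omega> = ?\<Omega> and T = ?G and x = x])
      (use that G_trans[OF x] ext CG x in auto)
  (* Automorphisms are determined by their value at x, so a set of automorphisms moving x to every
     point contains them all. *)
  have C_subset: "?C \<subseteq> K" if K: "K \<subseteq> ?C" "\<And>y. y \<in> ?\<Omega> \<Longrightarrow> \<exists>k\<in>K. k x = y" for K
  proof
    fix c assume c: "c \<in> ?C"
    then obtain k where "k \<in> K" "k x = c x" using K(2) closed x by blast
    then show "c \<in> K" using C_eqI[of k c] c K(1) by blast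
  qed
  show ?thesis
  proof (cases "?C = {\<one>\<^bsub>?B\<^esub>}")
    case True
    then have "trivial_group ?P"
      unfolding trivial_group_def carrier_P one_P using P.is_group by blast
    then show ?thesis ..
  next
    case False
    moreover have "?C = {\<one>\<^bsub>?B\<^esub>} \<or> transitive_perm_group ?\<Omega> ?C"
      by (rule primitive_centralising_subgroup[OF assms(3) C]) (rule CG)
    ultimately have C_trans: "transitive_perm_group ?\<Omega> ?C" by blast
    have "K = {\<one>\<^bsub>?P\<^esub>} \<or> K = carrier ?P" if "subgroup K ?P" for K
    proof -
      have K_sub: "K \<subseteq> ?C" using subgroup.subset[OF that] by (simp add: carrier_P)
      have K: "subgroup K ?B"
        using B.incl_subgroup[OF C] that by (simp add: perm_group_def)
      have "K = {\<one>\<^bsub>?B\<^esub>} \<or> transitive_perm_group ?\<Omega> K"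
        by (rule primitive_centralising_subgroup[OF assms(3) K]) (rule CG[OF subsetD[OF K_sub]])
      then show ?thesis
        using C_subset[OF K_sub] K_sub x
        by (auto simp: transitive_perm_group_iff[OF K] carrier_P one_P)
    qed
    then obtain p where p: "Factorial_Ring.prime p" "?P \<cong> integer_mod_group p"
      using P.only_trivial_subgroups_imp_prime_cyclic False carrier_P one_P by metis
    have "comm_group ?P"
      using comm_group.iso_imp_comm_group[OF abelian_integer_mod_group] P.iso_sym p(2)
        P.is_monoid by blast
    then have CC: "c (d y) = d (c y)" if "c \<in> ?C" "d \<in> ?C" "y \<in> ?\<Omega>" for c d y
    proof -
      have "c \<otimes>\<^bsub>?P\<^esub> d = d \<otimes>\<^bsub>?P\<^esub> c"
        using comm_groupE(4)[OF \<open>comm_group ?P\<close>] that by (simp add: carrier_P)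
      then have "compose ?\<Omega> c d = compose ?\<Omega> d c"
        using that Bij by (simp add: perm_group_def BijGroup_def)
      then show ?thesis using that(3) by (metis compose_eq)
    qed
    have "?G \<subseteq> ?C"
    proof
      fix g assume g: "g \<in> ?G"
      have C_tr: "\<exists>c\<in>?C. c x = y" if "y \<in> ?\<Omega>" for y
        using C_trans that x by (simp add: transitive_perm_group_iff[OF C])
      obtain c where c: "c \<in> ?C" "c x = g x"
        using C_tr closed g x by blast
      have "c = g"
      proof (rule commuting_with_transitive_eqI[OF C_tr])
        show "c \<in> extensional ?\<Omega>" "g \<in> extensional ?\<Omega>" using c g ext by auto
        show "c x = g x" by (rule c)
        fix t assume t: "t \<in> ?C"
        show "c (t x) = t (c x)" by (rule CC[OF c(1) t x])
        show "g (t x) = t (g x)" by (rule CG[OF t g x, symmetric])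
      qed
      then show "g \<in> ?C" using c by simp
    qed
    then have "?C = ?G" using C_subset[of ?G] G_trans[OF x] by blast
    then show ?thesis using C_trans p by (auto simp: regular_object_def)
  qed
qed

end
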